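(* Let $A$ and $B$ be two rings, with $B$ commutative. Let $n,m\in\mathbb{N}$. Let $f:A\to B$ be an $n$-homomorphism, and let $g:A\to B$ be an $m$-homomorphism. Then $f+g$ is an $(n+m)$-homomorphism.
   Context: Rings are associative and unital, not necessarily commutative. $\mathbb{N}=\{0,1,2,\ldots\}$, $[n]=\{1,2,\ldots,n\}$, and $S_n$ is the group of permutations of $[n]$; $(-1)^\sigma$ is the sign of $\sigma$. A cycle of a permutation $\sigma$ is a tuple $(i_1,\ldots,i_k)$ of distinct elements with $\sigma(i_j)=i_{j+1}$ for $j<k$ and $\sigma(i_k)=i_1$, considered up to cyclic rotation; fixed points count as $1$-cycles. Let $A$ be a ring, $B$ a commutative ring, and $f:A\to B$ a $\mathbb{Z}$-linear map (not required to be unital or multiplicative). We say $f$ is central if $f(aa')=f(a'a)$ for all $a,a'\in A$. If $f$ is central and $n\in\mathbb{N}$, the $n$-Frobenius map of $f$ is the $\mathbb{Z}$-multilinear map $f_n:A^n\to B$ given by $$f_n(a_1,\ldots,a_n)=\sum_{\sigma\in S_n}(-1)^\sigma\prod_{\substack{c=(i_1,i_2,\ldots,i_k)\\ \text{is a cycle of }\sigma}}f(a_{i_1}a_{i_2}\cdots a_{i_k})$$ (well-defined since $f$ is central; in particular $f_0()=1$ and $f_1=f$). For $n\in\mathbb{N}$, a $\mathbb{Z}$-linear map $f:A\to B$ is called an $n$-homomorphism if $f$ is central and $f_{n+1}=0$ identically. *)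

theory Defs
  imports Complex_Main "HOL-Combinatorics.Permutations"
begin

text \<open>
  The class \<open>ring_1\<close> contains the axiom \<open>0 \<noteq> 1\<close>. The sorts \<open>{ring, monoid_mult}\<close> and
  \<open>{comm_ring, comm_monoid_mult}\<close> describe unital rings and commutative unital rings with the
  zero ring allowed.
\<close>

definition central :: "('a::{ring,monoid_mult} \<Rightarrow> 'b::{comm_ring,comm_monoid_mult}) \<Rightarrow> bool"
  where "central f \<longleftrightarrow> (\<forall>x y. f (x * y) = f (y * x))"

definition cycle_tuples :: "nat \<Rightarrow> (nat \<Rightarrow> nat) \<Rightarrow> nat list set"
  where "cycle_tuples n \<sigma> = {c. c \<noteq> [] \<and> distinct c \<and> set c \<subseteq> {1..n} \<and>
    (\<forall>j. Suc j < length c \<longrightarrow> \<sigma> (c ! j) = c ! Suc j) \<and> \<sigma> (last c) = hd c}"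

definition rotation_rel :: "(nat list \<times> nat list) set"
  where "rotation_rel = {(c, d). \<exists>k. d = rotate k c}"

definition perm_cycles :: "nat \<Rightarrow> (nat \<Rightarrow> nat) \<Rightarrow> nat list set set"
  where "perm_cycles n \<sigma> = cycle_tuples n \<sigma> // rotation_rel"

text \<open>
  An element of \<open>A\<^sup>n\<close> is a function \<open>a\<close> on \<open>nat\<close> of which only the values on \<open>{1..n}\<close> are used.
  Each cycle, a rotation class of tuples, is evaluated at an arbitrary representative; for central
  \<open>f\<close> the choice is immaterial (\<open>cycle_value_well_defined\<close>). The case distinction is the
  sign of \<open>\<sigma>\<close> acting on the commutative ring.
\<close>

definition cycle_value ::
    "('a::{ring,monoid_mult} \<Rightarrow> 'b::{comm_ring,comm_monoid_mult}) \<Rightarrow> (nat \<Rightarrow> 'a) \<Rightarrow> nat list set \<Rightarrow> 'b"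
  where "cycle_value f a C = f (prod_list (map a (SOME c. c \<in> C)))"

definition frobenius_map ::
    "('a::{ring,monoid_mult} \<Rightarrow> 'b::{comm_ring,comm_monoid_mult}) \<Rightarrow> nat \<Rightarrow> (nat \<Rightarrow> 'a) \<Rightarrow> 'b"
  where "frobenius_map f n a = (\<Sum>\<sigma> | \<sigma> permutes {1..n}.
    let p = (\<Prod>C\<in>perm_cycles n \<sigma>. cycle_value f a C) in if evenperm \<sigma> then p else - p)"

text \<open>For maps between abelian groups, \<open>\<int>\<close>-linear means additive.\<close>

definition n_homomorphism ::
    "nat \<Rightarrow> ('a::{ring,monoid_mult} \<Rightarrow> 'b::{comm_ring,comm_monoid_mult}) \<Rightarrow> bool"
  where "n_homomorphism n f \<longleftrightarrow>
    additive f \<and> central f \<and> (\<forall>a. frobenius_map f (n + 1) a = 0)"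

lemma central_rotate:
  assumes "central f"
  shows "f (prod_list (map a (rotate k c))) = f (prod_list (map a c))"
proof (induction k)
  case (Suc k)
  have "f (prod_list (map a (rotate1 d))) = f (prod_list (map a d))" for d
    using assms by (cases d) (auto simp: central_def)
  with Suc show ?case by simp
qed simp

lemma cycle_value_well_defined:
  assumes "central f" "C \<in> perm_cycles n \<sigma>" "c \<in> C"
  shows "cycle_value f a C = f (prod_list (map a c))"
proof -
  obtain d where C: "C = {e. \<exists>k. e = rotate k d}"
    using assms(2) by (auto simp: perm_cycles_def quotient_def rotation_rel_def)
  have "(SOME c. c \<in> C) \<in> C"
    using assms(3) by (rule someI)
  with assms(1,3) show ?thesis
    by (auto simp: C cycle_value_def central_rotate)
qed

lemma frobenius_map_0: "frobenius_map f 0 a = 1"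
proof -
  have "perm_cycles 0 \<sigma> = {}" for \<sigma>
    by (auto simp: perm_cycles_def cycle_tuples_def quotient_def)
  then show ?thesis
    by (simp add: frobenius_map_def Let_def evenperm_id)
qed

lemma frobenius_map_1:
  assumes "central f"
  shows "frobenius_map f 1 a = f (a 1)"
proof -
  have tup: "cycle_tuples 1 id = {[1]}"
  proof -
    have "c = [1]" if c: "c \<noteq> []" "distinct c" "set c \<subseteq> {1::nat}" for c
    proof -
      have "card (set c) \<le> card {1::nat}" using c(3) by (intro card_mono) auto
      with c have "length c = 1" by (cases c) (auto simp: distinct_card)
      with c show ?thesis by (auto simp: length_Suc_conv)
    qed
    then show ?thesis by (auto simp: cycle_tuples_def)
  qed
  have cyc: "perm_cycles 1 id = {{[1]}}"
    unfolding perm_cycles_def tup by (auto simp: quotient_def rotation_rel_def)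
  have "{\<sigma>. \<sigma> permutes {1..1::nat}} = {id}" by auto
  then show ?thesis
    by (simp add: frobenius_map_def Let_def evenperm_id cyc[simplified] cycle_value_def)
qed

end

theory Submission
  imports Defs "HOL-Combinatorics.Cycles"
begin

text \<open>
  Splitting the permutations of \<open>{1..n+1}\<close> according to the image of \<open>n + 1\<close> gives the recursion
  \<open>f\<^sub>n\<^sub>+\<^sub>1(a\<^sub>1,\<dots>,a\<^sub>n,x) = f(x) f\<^sub>n(a\<^sub>1,\<dots>,a\<^sub>n) - \<Sum>\<^sub>i f\<^sub>n(a\<^sub>1,\<dots>,x a\<^sub>i,\<dots>,a\<^sub>n)\<close>.
  It shows that \<open>f\<^sub>k = 0\<close> implies \<open>f\<^sub>l = 0\<close> for all \<open>l \<ge> k\<close>, and, by induction, that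
  \<open>(f + g)\<^sub>k\<close> is the sum of \<open>f\<^sub>|\<^sub>I\<^sub>|(a\<^sub>I) g\<^sub>|\<^sub>J\<^sub>|(a\<^sub>J)\<close> over all partitions of \<open>{1..k}\<close> into two parts \<open>I\<close>
  and \<open>J\<close>. For \<open>k = n + m + 1\<close>, either \<open>|I| > n\<close> or \<open>|J| > m\<close>, so every summand vanishes.
\<close>

section \<open>Cycles of a permutation\<close>

text \<open>As an equation between lists, the cycle condition is visibly stable under rotation and
  can be checked by list rewriting.\<close>

lemma cycle_tuples_altdef:
  "cycle_tuples n \<sigma> = {c. c \<noteq> [] \<and> distinct c \<and> set c \<subseteq> {1..n} \<and> map \<sigma> c = rotate1 c}"
proof -
  have "((\<forall>j. Suc j < length c \<longrightarrow> \<sigma> (c ! j) = c ! Suc j) \<and> \<sigma> (last c) = hd c) \<longleftrightarrow>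
      map \<sigma> c = rotate1 c" (is "?L \<longleftrightarrow> ?R") if "c \<noteq> []" for c
  proof
    assume L: ?L
    show ?R
    proof (rule nth_equalityI)
      fix j assume "j < length (map \<sigma> c)"
      then consider "Suc j < length c" | "Suc j = length c" by fastforce
      then show "map \<sigma> c ! j = rotate1 c ! j"
      proof cases
        case 1 then show ?thesis using L by (simp add: nth_rotate1)
      next
        case 2
        then have "j = length c - 1" by simp
        then have "c ! j = last c" using that by (simp add: last_conv_nth)
        with 2 L that show ?thesis by (simp add: nth_rotate1 hd_conv_nth flip: 2)
      qed
    qed simp
  next
    assume R: ?R
    have *: "\<sigma> (c ! j) = c ! (Suc j mod length c)" if "j < length c" for j
      using arg_cong[OF R, of "\<lambda>d. d ! j"] that by (simp add: nth_rotate1)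
    show ?L
      using *[of "length c - 1"] * that by (auto simp: last_conv_nth hd_conv_nth)
  qed
  then show ?thesis unfolding cycle_tuples_def by blast
qed

lemma rotate_in_cycle_tuples:
  assumes "c \<in> cycle_tuples n \<sigma>"
  shows "rotate k c \<in> cycle_tuples n \<sigma>"
  using assms by (auto simp: cycle_tuples_altdef rotate_map[symmetric] rotate1_rotate_swap)

lemma finite_cycle_tuples: "finite (cycle_tuples n \<sigma>)"
  by (rule finite_subset[OF _ finite_subset_distinct[of "{1..n}"]])
    (auto simp: cycle_tuples_def)

lemma rotate_to_front:
  assumes "x \<in> set c"
  obtains k e where "rotate k c = x # e"
proof -
  obtain ys zs where "c = ys @ x # zs" using assms by (meson split_list)
  then have "rotate (length ys) c = x # zs @ ys" by (simp add: rotate_append)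
  then show ?thesis using that by blast
qed

lemma rotate_back: "\<exists>j. rotate j (rotate k c) = c"
proof (cases "c = []")
  case False
  have "rotate (length c - k mod length c) (rotate (k mod length c) c) = c"
    using False by (simp add: rotate_rotate)
  then show ?thesis by (metis rotate_conv_mod)
qed simp

lemma cycle_tuple_nth:
  assumes "c \<in> cycle_tuples n \<sigma>"
  shows "j < length c \<Longrightarrow> c ! j = (\<sigma> ^^ j) (hd c)"
    and "(\<sigma> ^^ length c) (hd c) = hd c"
proof -
  have c: "c \<noteq> []" using assms by (simp add: cycle_tuples_def)
  show *: "j < length c \<Longrightarrow> c ! j = (\<sigma> ^^ j) (hd c)" for j
  proof (induction j)
    case (Suc j)
    then show ?case using assms by (auto simp: cycle_tuples_def)
  qed (use c in \<open>simp add: hd_conv_nth\<close>)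
  obtain l where l: "length c = Suc l" using c by (cases c) auto
  then have "last c = (\<sigma> ^^ l) (hd c)" using *[of l] c by (simp add: last_conv_nth)
  then show "(\<sigma> ^^ length c) (hd c) = hd c" using assms l by (auto simp: cycle_tuples_def)
qed

text \<open>Otherwise \<open>d\<close> would return to its head at position \<open>length c\<close>,
  contradicting distinctness.\<close>

lemma cycle_tuple_length_le:
  assumes c: "c \<in> cycle_tuples n \<sigma>" and d: "d \<in> cycle_tuples n \<sigma>" and hd: "hd c = hd d"
  shows "length d \<le> length c"
proof (rule ccontr)
  assume "\<not> length d \<le> length c"
  then have "d ! length c = hd d"
    using cycle_tuple_nth(1)[OF d, of "length c"] cycle_tuple_nth(2)[OF c] hd by simp
  moreover have "hd d = d ! 0" using d by (simp add: cycle_tuples_def hd_conv_nth)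
  moreover have "distinct d" "c \<noteq> []" "d \<noteq> []" using c d by (auto simp: cycle_tuples_def)
  ultimately show False
    using \<open>\<not> length d \<le> length c\<close> nth_eq_iff_index_eq[of d "length c" 0] by simp
qed

lemma cycle_tuple_unique:
  assumes "c \<in> cycle_tuples n \<sigma>" "d \<in> cycle_tuples n \<sigma>" "hd c = hd d"
  shows "c = d"
proof (rule nth_equalityI)
  show len: "length c = length d"
    using assms cycle_tuple_length_le by (metis le_antisym)
  show "c ! j = d ! j" if "j < length c" for j
    using cycle_tuple_nth(1)[OF assms(1)] cycle_tuple_nth(1)[OF assms(2)] assms(3) len that
    by simp
qed

text \<open>Rotating two tuples until \<open>x\<close> comes first gives them the same head, hence
  makes them equal. A cycle can therefore be singled out by any one of its points.\<close>

lemma rotation_class_eq: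
  assumes c: "c \<in> cycle_tuples n \<sigma>" and x: "x \<in> set c"
  shows "rotation_rel `` {c} = {d \<in> cycle_tuples n \<sigma>. x \<in> set d}"
proof (intro equalityI subsetI)
  fix d assume "d \<in> rotation_rel `` {c}"
  then show "d \<in> {d \<in> cycle_tuples n \<sigma>. x \<in> set d}"
    using rotate_in_cycle_tuples[OF c] x by (auto simp: rotation_rel_def)
next
  fix d assume d: "d \<in> {d \<in> cycle_tuples n \<sigma>. x \<in> set d}"
  obtain k e where k: "rotate k c = x # e" using rotate_to_front[OF x] .
  have "x \<in> set d" using d by simp
  then obtain j e' where j: "rotate j d = x # e'" by (rule rotate_to_front)
  have "rotate k c = rotate j d"
  proof (rule cycle_tuple_unique)
    show "rotate k c \<in> cycle_tuples n \<sigma>" "rotate j d \<in> cycle_tuples n \<sigma>"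
      using c d rotate_in_cycle_tuples by blast+
  qed (simp add: k j)
  moreover obtain i where "rotate i (rotate j d) = d" using rotate_back by blast
  ultimately have "d = rotate (i + k) c" by (metis rotate_rotate)
  then show "d \<in> rotation_rel `` {c}" by (auto simp: rotation_rel_def)
qed

lemma self_in_rotation_class: "c \<in> rotation_rel `` {c}"
  using rotate0 by (auto simp: rotation_rel_def intro!: exI[of _ 0])

text \<open>The tuple lists the iterates of \<open>x\<close> up to its first return, whose time is
  \<open>least_power \<sigma> x\<close>.\<close>

lemma cycle_tuple_exists:
  assumes \<sigma>: "\<sigma> permutes {1..n}" and x: "x \<in> {1..n}"
  obtains e where "x # e \<in> cycle_tuples n \<sigma>"
proof -
  have perm: "permutation \<sigma>" using \<sigma> by (auto simp: permutation_permutes)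
  define l where "l = least_power \<sigma> x"
  have l: "(\<sigma> ^^ l) x = x" "l > 0"
    using least_power_of_permutation[OF perm, of x] by (auto simp: l_def)
  define c where "c = map (\<lambda>i. (\<sigma> ^^ i) x) [0..<l]"
  have "distinct c" using cycle_of_permutation[OF perm, of x] by (simp add: c_def l_def)
  moreover have "set c \<subseteq> {1..n}"
    using permutes_in_image[OF permutes_funpow[OF \<sigma>]] x by (auto simp: c_def)
  moreover have "map \<sigma> c = rotate1 c"
  proof (rule nth_equalityI)
    fix j assume "j < length (map \<sigma> c)"
    then have "j < l" by (simp add: c_def)
    then show "map \<sigma> c ! j = rotate1 c ! j"
      using l by (cases "Suc j = l") (auto simp: c_def nth_rotate1)
  qed simp
  moreover have "c = x # tl c" using l by (cases l) (auto simp: c_def upt_conv_Cons simp del: upt_Suc)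
  ultimately show ?thesis using that[of "tl c"] by (auto simp: cycle_tuples_altdef)
qed

section \<open>Values of cycles and products over cycles\<close>

lemma cycle_value_rotation_class:
  assumes "central f"
  shows "cycle_value f a (rotation_rel `` {c}) = f (prod_list (map a c))"
proof -
  have "(SOME d. d \<in> rotation_rel `` {c}) \<in> rotation_rel `` {c}"
    using self_in_rotation_class by (rule someI)
  then show ?thesis
    using assms by (auto simp: cycle_value_def rotation_rel_def central_rotate)
qed

text \<open>The product is taken over an arbitrary set of tuples, so that it also applies to the
  cycles avoiding a given point.\<close>

definition cycle_prod ::
    "('a::{ring,monoid_mult} \<Rightarrow> 'b::{comm_ring,comm_monoid_mult}) \<Rightarrow> (nat \<Rightarrow> 'a) \<Rightarrow> nat list set \<Rightarrow> 'b"
  where "cycle_prod f a T = (\<Prod>C\<in>T // rotation_rel. cycle_value f a C)"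

lemma frobenius_map_altdef:
  "frobenius_map f n a = (\<Sum>\<sigma> | \<sigma> permutes {1..n}.
    if evenperm \<sigma> then cycle_prod f a (cycle_tuples n \<sigma>) else - cycle_prod f a (cycle_tuples n \<sigma>))"
  unfolding frobenius_map_def perm_cycles_def cycle_prod_def Let_def ..

text \<open>All tuples through \<open>i\<close> form the single class of \<open>c\<close>; its
  factor is split off and the tuples avoiding \<open>i\<close> remain.\<close>

lemma cycle_prod_split:
  assumes f: "central f" and c: "c \<in> cycle_tuples n \<sigma>" and i: "i \<in> set c"
  shows "cycle_prod f a (cycle_tuples n \<sigma>) =
    f (prod_list (map a c)) * cycle_prod f a {d \<in> cycle_tuples n \<sigma>. i \<notin> set d}"
proof -
  let ?R = "{d \<in> cycle_tuples n \<sigma>. i \<notin> set d}"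
  have same: "rotation_rel `` {d} = rotation_rel `` {c}"
    if "d \<in> cycle_tuples n \<sigma>" "i \<in> set d" for d
    using rotation_class_eq[OF that] rotation_class_eq[OF c i] by simp
  have q: "cycle_tuples n \<sigma> // rotation_rel = insert (rotation_rel `` {c}) (?R // rotation_rel)"
  proof (intro equalityI subsetI)
    fix C assume "C \<in> cycle_tuples n \<sigma> // rotation_rel"
    then show "C \<in> insert (rotation_rel `` {c}) (?R // rotation_rel)"
      using same by (fastforce simp: quotient_def)
  qed (use c in \<open>auto simp: quotient_def\<close>)
  have "rotation_rel `` {c} \<notin> ?R // rotation_rel"
  proof
    assume "rotation_rel `` {c} \<in> ?R // rotation_rel"
    then obtain d where d: "i \<notin> set d" "rotation_rel `` {c} = rotation_rel `` {d}"
      by (auto simp: quotient_def)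
    then have "c \<in> rotation_rel `` {d}" using self_in_rotation_class by metis
    with d i show False by (auto simp: rotation_rel_def)
  qed
  moreover have "finite (?R // rotation_rel)"
    using finite_cycle_tuples by (auto simp: quotient_def)
  ultimately show ?thesis
    unfolding cycle_prod_def q using cycle_value_rotation_class[OF f] by simp
qed

lemma cycle_prod_cong:
  assumes "central f" "\<And>c x. c \<in> T \<Longrightarrow> x \<in> set c \<Longrightarrow> a x = b x"
  shows "cycle_prod f a T = cycle_prod f b T"
  unfolding cycle_prod_def
proof (rule prod.cong)
  fix C assume "C \<in> T // rotation_rel"
  then obtain c where "c \<in> T" "C = rotation_rel `` {c}" by (auto simp: quotient_def)
  moreover from this have "map a c = map b c" using assms(2) by simp
  ultimately show "cycle_value f a C = cycle_value f b C"
    using cycle_value_rotation_class[OF assms(1)] by metis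
qed simp

section \<open>The recursion for Frobenius maps\<close>

lemma cycle_prod_fixpoint:
  assumes f: "central f" and \<tau>: "\<tau> permutes {1..n}"
  shows "cycle_prod f a (cycle_tuples (Suc n) \<tau>) = f (a (Suc n)) * cycle_prod f a (cycle_tuples n \<tau>)"
proof -
  have "[Suc n] \<in> cycle_tuples (Suc n) \<tau>"
    using permutes_not_in[OF \<tau>] by (simp add: cycle_tuples_altdef)
  moreover have "{d \<in> cycle_tuples (Suc n) \<tau>. Suc n \<notin> set d} = cycle_tuples n \<tau>"
    by (fastforce simp: cycle_tuples_def le_Suc_eq subset_iff)
  ultimately show ?thesis using cycle_prod_split[OF f, of "[Suc n]"] by simp
qed

text \<open>Composing with the transposition inserts \<open>n + 1\<close> directly before \<open>i\<close> in its cycle.\<close>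

lemma cycle_prod_insert:
  assumes f: "central f" and \<tau>: "\<tau> permutes {1..n}" and i: "i \<in> {1..n}"
  shows "cycle_prod f a (cycle_tuples (Suc n) (transpose (Suc n) i \<circ> \<tau>)) =
    cycle_prod f (a(i := a (Suc n) * a i)) (cycle_tuples n \<tau>)"
proof -
  let ?\<sigma> = "transpose (Suc n) i \<circ> \<tau>" and ?b = "a(i := a (Suc n) * a i)"
  obtain e where e: "i # e \<in> cycle_tuples n \<tau>" using cycle_tuple_exists[OF \<tau> i] .
  have \<tau>N: "\<tau> (Suc n) = Suc n" using permutes_not_in[OF \<tau>] by simp
  have ie: "i \<notin> set e" "Suc n \<notin> set e" "Suc n \<noteq> i" using e by (auto simp: cycle_tuples_def)
  have tr: "transpose (Suc n) i y = y" if "y \<in> set e" for y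
    using ie that by (auto simp: transpose_def)
  have m: "map \<tau> (i # e) = e @ [i]" using e by (simp add: cycle_tuples_altdef)
  \<comment> \<open>The transposition only redirects the closing step: the cycle now goes to
    \<open>Suc n\<close> instead of \<open>i\<close>, and from there to \<open>i\<close>.\<close>
  have "map ?\<sigma> (i # e) = map (transpose (Suc n) i) (e @ [i])"
    unfolding m[symmetric] by simp
  also have "\<dots> = e @ [Suc n]" using tr by (simp add: map_idI)
  finally have "map ?\<sigma> (Suc n # i # e) = rotate1 (Suc n # i # e)" using \<tau>N by simp
  moreover have "set (i # e) \<subseteq> {1..n}" "distinct (i # e)"
    using e by (simp_all add: cycle_tuples_def)
  ultimately have "Suc n # i # e \<in> cycle_tuples (Suc n) ?\<sigma>"
    unfolding cycle_tuples_altdef by fastforce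
  \<comment> \<open>A cycle of the composite that avoids \<open>i\<close> also avoids
    \<open>Suc n\<close>, which is sent to \<open>i\<close>. On cycles avoiding both points the
    transposition has no effect.\<close>
  moreover have "{d \<in> cycle_tuples (Suc n) ?\<sigma>. i \<notin> set d} = {d \<in> cycle_tuples n \<tau>. i \<notin> set d}"
    (is "?A = ?B")
  proof (intro equalityI subsetI)
    fix d assume d: "d \<in> ?A"
    have img: "?\<sigma> x \<in> set d" if "x \<in> set d" for x
    proof -
      have "?\<sigma> x \<in> set (map ?\<sigma> d)" using that by (simp only: set_map image_eqI)
      also have "map ?\<sigma> d = rotate1 d" using d by (simp add: cycle_tuples_altdef)
      finally show ?thesis by simp
    qed
    have N: "Suc n \<notin> set d" using img[of "Suc n"] d \<tau>N by auto
    have "?\<sigma> x = \<tau> x" if "x \<in> set d" for x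
      using img[OF that] N d by (auto simp: transpose_def split: if_splits)
    then have "map \<tau> d = map ?\<sigma> d" by simp
    then have "map \<tau> d = rotate1 d" using d by (simp add: cycle_tuples_altdef del: map_eq_conv)
    moreover have "set d \<subseteq> {1..n}"
      using d N by (fastforce simp: cycle_tuples_def le_Suc_eq)
    ultimately show "d \<in> ?B" using d by (simp add: cycle_tuples_altdef)
  next
    fix d assume d: "d \<in> ?B"
    have "?\<sigma> x = \<tau> x" if "x \<in> set d" for x
    proof -
      have "\<tau> x \<in> set (map \<tau> d)" using that by simp
      also have "map \<tau> d = rotate1 d" using d by (simp add: cycle_tuples_altdef)
      finally have "\<tau> x \<in> set d" by simp
      then show ?thesis using d by (auto simp: transpose_def cycle_tuples_altdef)
    qed
    then have "map ?\<sigma> d = map \<tau> d" by simp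
    then have "map ?\<sigma> d = rotate1 d" using d by (simp add: cycle_tuples_altdef del: map_eq_conv)
    then show "d \<in> ?A" using d by (auto simp: cycle_tuples_altdef)
  qed
  moreover have "cycle_prod f a ?B = cycle_prod f ?b ?B"
    by (rule cycle_prod_cong[OF f]) auto
  \<comment> \<open>Under the updated arguments the tuple \<open>i # e\<close> has the same product
    as \<open>Suc n # i # e\<close> under \<open>a\<close>.\<close>
  moreover have "map ?b e = map a e" using ie by simp
  ultimately show ?thesis
    using cycle_prod_split[OF f, of "Suc n # i # e" "Suc n" ?\<sigma> i a]
      cycle_prod_split[OF f e, of i ?b] by (simp add: mult.assoc del: map_eq_conv)
qed

text \<open>Each permutation of \<open>{1..Suc n}\<close> is uniquely
  \<open>transpose (Suc n) i \<circ> \<tau>\<close> with \<open>\<tau>\<close> permuting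
  \<open>{1..n}\<close>. For \<open>i = Suc n\<close> the transposition is the identity; for the
  other \<open>i\<close> it reverses the sign.\<close>

lemma frobenius_map_Suc:
  assumes f: "central f"
  shows "frobenius_map f (Suc n) a =
    f (a (Suc n)) * frobenius_map f n a - (\<Sum>i=1..n. frobenius_map f n (a(i := a (Suc n) * a i)))"
proof -
  let ?N = "Suc n" and ?P = "{\<tau>. \<tau> permutes {1..n}}"
  let ?t = "\<lambda>k a \<sigma>. if evenperm \<sigma> then cycle_prod f a (cycle_tuples k \<sigma>)
    else - cycle_prod f a (cycle_tuples k \<sigma>)"
  have fix_case: "?t ?N a \<tau> = f (a ?N) * ?t n a \<tau>" if "\<tau> permutes {1..n}" for \<tau>
    using cycle_prod_fixpoint[OF f that] by simp
  have ins_case: "?t ?N a (transpose ?N i \<circ> \<tau>) = - ?t n (a(i := a ?N * a i)) \<tau>"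
    if \<tau>: "\<tau> permutes {1..n}" and i: "i \<in> {1..n}" for \<tau> i
  proof -
    have "permutation \<tau>" using \<tau> by (auto simp: permutation_permutes)
    then have "evenperm (transpose ?N i \<circ> \<tau>) \<longleftrightarrow> \<not> evenperm \<tau>"
      using i by (simp add: evenperm_comp permutation_swap_id evenperm_swap)
    then show ?thesis using cycle_prod_insert[OF f \<tau> i] by simp
  qed
  have "frobenius_map f ?N a = (\<Sum>\<sigma> | \<sigma> permutes insert ?N {1..n}. ?t ?N a \<sigma>)"
    by (simp add: frobenius_map_altdef atLeastAtMostSuc_conv)
  also have "\<dots> = (\<Sum>i\<in>insert ?N {1..n}. \<Sum>\<tau>\<in>?P. ?t ?N a (transpose ?N i \<circ> \<tau>))"
    by (rule sum_over_permutations_insert) auto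
  also have "\<dots> = (\<Sum>\<tau>\<in>?P. ?t ?N a \<tau>) + (\<Sum>i=1..n. \<Sum>\<tau>\<in>?P. ?t ?N a (transpose ?N i \<circ> \<tau>))"
    by (simp cong: if_cong)
  also have "(\<Sum>\<tau>\<in>?P. ?t ?N a \<tau>) = f (a ?N) * frobenius_map f n a"
    unfolding frobenius_map_altdef sum_distrib_left
    by (rule sum.cong[OF refl], rule fix_case) simp
  also have "(\<Sum>i=1..n. \<Sum>\<tau>\<in>?P. ?t ?N a (transpose ?N i \<circ> \<tau>)) =
      (\<Sum>i=1..n. - frobenius_map f n (a(i := a ?N * a i)))"
    unfolding frobenius_map_altdef sum_negf[symmetric]
    by (intro sum.cong refl ins_case) simp_all
  finally show ?thesis by (simp add: sum_negf)
qed

text \<open>This is the recursion of \<open>frobenius_map_Suc\<close> with the last argument as head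
  of the list. Lists allow the arguments to be split into subsequences without renumbering.\<close>

fun frob_list ::
    "('a::{ring,monoid_mult} \<Rightarrow> 'b::{comm_ring,comm_monoid_mult}) \<Rightarrow> 'a list \<Rightarrow> 'b"
  where
    "frob_list f [] = 1"
  | "frob_list f (x # xs) =
      f x * frob_list f xs - (\<Sum>i<length xs. frob_list f (xs[i := x * xs ! i]))"

lemma frobenius_map_eq_frob_list:
  assumes f: "central f"
  shows "frobenius_map f n a = frob_list f (map a (rev [1..<Suc n]))"
proof (induction n arbitrary: a)
  case 0
  then show ?case by (simp add: frobenius_map_0)
next
  case (Suc n)
  let ?x = "a (Suc n)" and ?xs = "map a (rev [1..<Suc n])"
  \<comment> \<open>Position \<open>j\<close> of the reversed list, counted from 0, holds argument
    \<open>n - j\<close>.\<close>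
  have upd: "map (a(n - j := ?x * a (n - j))) (rev [1..<Suc n]) = ?xs[j := ?x * ?xs ! j]"
    if "j < n" for j
    using that by (intro nth_equalityI) (auto simp: nth_list_update rev_nth simp del: upt_Suc)
  have "(\<Sum>i=1..n. frobenius_map f n (a(i := ?x * a i))) =
      (\<Sum>j<n. frobenius_map f n (a(n - j := ?x * a (n - j))))"
    by (rule sum.reindex_bij_witness[of _ "\<lambda>j. n - j" "\<lambda>i. n - i"]) auto
  also have "\<dots> = (\<Sum>j<length ?xs. frob_list f (?xs[j := ?x * ?xs ! j]))"
    unfolding Suc.IH by (intro sum.cong arg_cong[where f = "frob_list f"] upd) (simp_all del: upt_Suc)
  finally show ?case
    using frobenius_map_Suc[OF f, of n a] Suc.IH[of a] by simp
qed

text \<open>Length \<open>Suc n\<close> is the hypothesis on \<open>f\<close>. For longer lists,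
  each term of the recursion contains the value at a list one shorter, which still has more than
  \<open>n\<close> entries.\<close>

lemma n_homomorphism_frob_list:
  assumes f: "n_homomorphism n f" and xs: "length xs > n"
  shows "frob_list f xs = 0"
  using xs
proof (induction "length xs" arbitrary: xs rule: less_induct)
  case less
  show ?case
  proof (cases "length xs = Suc n")
    case True
    \<comment> \<open>The arguments are numbered backwards to cancel the reversal in
      \<open>frobenius_map_eq_frob_list\<close>.\<close>
    have "map (\<lambda>k. xs ! (Suc n - k)) (rev [1..<Suc (Suc n)]) = xs"
      using True by (intro nth_equalityI) (auto simp: rev_nth simp del: upt_Suc)
    then show ?thesis
      using f frobenius_map_eq_frob_list[of f "Suc n" "\<lambda>k. xs ! (Suc n - k)"]
      by (simp add: n_homomorphism_def del: upt_Suc)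
  next
    case False
    then obtain y ys where xs: "xs = y # ys" "length ys > n"
      using less.prems by (cases xs) auto
    then show ?thesis using less.hyps by simp
  qed
qed

section \<open>Sums of maps\<close>

text \<open>The sum of \<open>h u v\<close> over all ways to split a list into two complementary subsequences.\<close>

fun sum_splits :: "('a list \<Rightarrow> 'a list \<Rightarrow> 'b::comm_ring) \<Rightarrow> 'a list \<Rightarrow> 'b"
  where
    "sum_splits h [] = h [] []"
  | "sum_splits h (x # xs) =
      sum_splits (\<lambda>u v. h (x # u) v) xs + sum_splits (\<lambda>u v. h u (x # v)) xs"

lemma sum_splits_add:
  "sum_splits (\<lambda>u v. h u v + h' u v) xs = sum_splits h xs + sum_splits h' xs"
  by (induction xs arbitrary: h h') (simp_all add: algebra_simps)

lemma sum_splits_diff: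
  "sum_splits (\<lambda>u v. h u v - h' u v) xs = sum_splits h xs - sum_splits h' xs"
  by (induction xs arbitrary: h h') (simp_all add: add_diff_add)

lemma sum_splits_mult: "sum_splits (\<lambda>u v. c * h u v) xs = c * sum_splits h xs"
  by (induction xs arbitrary: h) (simp_all add: algebra_simps)

lemma sum_splits_eq_0:
  assumes "\<And>u v. length u + length v = length xs \<Longrightarrow> h u v = 0"
  shows "sum_splits h xs = 0"
  using assms by (induction xs arbitrary: h) simp_all

text \<open>In every splitting the modified entry lies in exactly one of the two parts.\<close>

lemma sum_splits_update:
  "(\<Sum>i<length xs. sum_splits h (xs[i := \<phi> (xs ! i)])) =
    sum_splits (\<lambda>u v. (\<Sum>i<length u. h (u[i := \<phi> (u ! i)]) v) +
      (\<Sum>i<length v. h u (v[i := \<phi> (v ! i)]))) xs"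
proof (induction xs arbitrary: h)
  case (Cons x xs)
  show ?case
    by (simp add: sum.lessThan_Suc_shift sum.distrib Cons.IH sum_splits_add algebra_simps
        del: sum.lessThan_Suc)
qed simp

lemma frob_list_add:
  "frob_list (\<lambda>x. f x + g x) xs = sum_splits (\<lambda>u v. frob_list f u * frob_list g v) xs"
proof (induction "length xs" arbitrary: xs rule: less_induct)
  case less
  let ?h = "\<lambda>u v. frob_list f u * frob_list g v"
  show ?case
  proof (cases xs)
    case (Cons x ys)
    have "frob_list (\<lambda>x. f x + g x) xs =
        (f x + g x) * sum_splits ?h ys - (\<Sum>i<length ys. sum_splits ?h (ys[i := x * ys ! i]))"
      using Cons less by simp
    also have "\<dots> = sum_splits (\<lambda>u v. (f x + g x) * ?h u v -
        ((\<Sum>i<length u. ?h (u[i := x * u ! i]) v) + (\<Sum>i<length v. ?h u (v[i := x * v ! i])))) ys"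
      by (simp add: sum_splits_update sum_splits_diff sum_splits_mult)
    \<comment> \<open>The term with \<open>f x\<close> and the updates of \<open>u\<close> form the
      recursion for \<open>x # u\<close>; the term with \<open>g x\<close> and the updates of
      \<open>v\<close> form the one for \<open>x # v\<close>.\<close>
    also have "\<dots> = sum_splits (\<lambda>u v. ?h (x # u) v + ?h u (x # v)) ys"
      by (simp add: algebra_simps sum_distrib_left sum_distrib_right)
    also have "\<dots> = sum_splits ?h xs"
      using Cons by (simp only: sum_splits_add sum_splits.simps)
    finally show ?thesis .
  qed simp
qed

theorem theorem0p3:
  fixes f g :: "'a::{ring,monoid_mult} \<Rightarrow> 'b::{comm_ring,comm_monoid_mult}"
    and n m :: nat
  assumes "n_homomorphism n f"
    and "n_homomorphism m g"
  shows "n_homomorphism (n + m) (\<lambda>x. f x + g x)"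
proof -
  have "additive (\<lambda>x. f x + g x)"
    using assms by (auto simp: n_homomorphism_def additive_def algebra_simps)
  moreover have c: "central (\<lambda>x. f x + g x)"
    using assms by (auto simp: n_homomorphism_def central_def)
  moreover have "frobenius_map (\<lambda>x. f x + g x) (n + m + 1) a = 0" for a
    unfolding frobenius_map_eq_frob_list[OF c] frob_list_add
  proof (rule sum_splits_eq_0)
    fix u v :: "'a list"
    assume "length u + length v = length (map a (rev [1..<Suc (n + m + 1)]))"
    then have "length u > n \<or> length v > m" by (auto simp del: upt_Suc)
    then show "frob_list f u * frob_list g v = 0"
      using n_homomorphism_frob_list[OF assms(1)] n_homomorphism_frob_list[OF assms(2)] by auto
  qed
  ultimately show ?thesis by (simp add: n_homomorphism_def)
qed

end
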